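(* Let $\mathcal{H}_d$ be a $d$-dimensional complex Hilbert space and let $\rho,\sigma$ be density operators on $\mathcal{H}_d$. Then $$\mathrm{F}(\rho,\sigma)\;\geqslant\; 1-\frac12\,\frac{e^{\frac12 \mathrm{S}_{\max}(\rho\|\sigma)}}{1+e^{\frac12 \mathrm{S}_{\max}(\rho\|\sigma)}}\,\|\rho-\sigma\|_1,$$ where the fraction $\frac{e^{\frac12 \mathrm{S}_{\max}(\rho\|\sigma)}}{1+e^{\frac12 \mathrm{S}_{\max}(\rho\|\sigma)}}$ is read as $1$ when $\mathrm{S}_{\max}(\rho\|\sigma)=+\infty$.
   Context: A density operator on $\mathcal{H}_d$ is a positive semidefinite operator with unit trace. The fidelity of two density operators is $\mathrm{F}(\rho,\sigma):=\operatorname{Tr}\sqrt{\sqrt{\rho}\,\sigma\sqrt{\rho}}$ (the non-squared version). The trace norm is $\|\rho-\sigma\|_1:=\operatorname{Tr}\sqrt{(\rho-\sigma)^2}$. The max-relative entropy is $\mathrm{S}_{\max}(\rho\|\sigma):=\min\{\gamma\in\mathbb{R}:\rho\leqslant e^{\gamma}\sigma\}$, where $\leqslant$ is the Loewner order ($A\leqslant B$ iff $B-A$ is positive semidefinite), with the value $+\infty$ if no such $\gamma$ exists; it is finite if and only if the support of $\rho$ is contained in the support of $\sigma$. *)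

theory Defs
  imports
    "HOL-Library.Extended_Real"
    "Jordan_Normal_Form.Schur_Decomposition"
begin

text \<open>
  A \<open>d\<close>-dimensional complex Hilbert space is represented, after a choice of orthonormal basis, by
  \<open>\<complex>\<^sup>d\<close>, and operators on it by complex \<open>d \<times> d\<close> matrices.
\<close>

definition psd_mat :: "complex mat \<Rightarrow> bool" where
  "psd_mat A \<longleftrightarrow> square_mat A \<and> mat_adjoint A = A \<and>
     (\<forall>v \<in> carrier_vec (dim_row A). 0 \<le> Re ((A *\<^sub>v v) \<bullet>c v))"

definition loewner_le :: "complex mat \<Rightarrow> complex mat \<Rightarrow> bool" where
  "loewner_le A B \<longleftrightarrow> psd_mat (B - A)"

definition mat_trace :: "complex mat \<Rightarrow> complex" where
  "mat_trace A = (\<Sum>i<dim_row A. A $$ (i, i))"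

definition density_mat :: "nat \<Rightarrow> complex mat \<Rightarrow> bool" where
  "density_mat d \<rho> \<longleftrightarrow> \<rho> \<in> carrier_mat d d \<and> psd_mat \<rho> \<and> mat_trace \<rho> = 1"

text \<open>The unique positive semidefinite square root; only meaningful if \<open>psd_mat A\<close>.\<close>

definition mat_sqrt :: "complex mat \<Rightarrow> complex mat" where
  "mat_sqrt A = (THE S. psd_mat S \<and> S * S = A)"

text \<open>
  In the next two definitions the trace is that of a positive semidefinite matrix, hence real,
  whenever \<open>\<rho>\<close> and \<open>\<sigma>\<close> are positive semidefinite of equal dimension; \<open>Re\<close> only changes the type.
\<close>

definition fidelity :: "complex mat \<Rightarrow> complex mat \<Rightarrow> real" where
  "fidelity \<rho> \<sigma> = Re (mat_trace (mat_sqrt (mat_sqrt \<rho> * \<sigma> * mat_sqrt \<rho>)))"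

text \<open>For Hermitian \<open>A\<close>, so that the absolute value of \<open>A\<close> is the square root of \<open>A\<^sup>2\<close>.\<close>

definition trace_norm :: "complex mat \<Rightarrow> real" where
  "trace_norm A = Re (mat_trace (mat_sqrt (A * A)))"

text \<open>
  For density matrices the set of admissible \<open>\<gamma>\<close> is empty or has a least element: taking traces
  in \<open>\<rho> \<le> e\<^sup>\<gamma> \<sigma>\<close> bounds it below by \<open>0\<close>, and it is closed.
\<close>

definition max_rel_entropy :: "complex mat \<Rightarrow> complex mat \<Rightarrow> ereal" where
  "max_rel_entropy \<rho> \<sigma> =
     (if \<exists>\<gamma>::real. loewner_le \<rho> (complex_of_real (exp \<gamma>) \<cdot>\<^sub>m \<sigma>)
      then ereal (LEAST \<gamma>::real. loewner_le \<rho> (complex_of_real (exp \<gamma>) \<cdot>\<^sub>m \<sigma>))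
      else \<infinity>)"

end

theory Submission
  imports Defs
begin

text \<open>
  By Fuchs and Caves, the fidelity of \<open>\<rho>\<close> and \<open>\<sigma>\<close> equals the classical fidelity
  \<open>\<Sum>\<^sub>i sqrt (p\<^sub>i q\<^sub>i)\<close> of the outcome distributions of some projective measurement. A measurement
  can only decrease the trace norm of \<open>\<rho> - \<sigma>\<close> and preserves \<open>\<rho> \<le> \<lambda>\<^sup>2 \<sigma>\<close>, so it suffices to treat
  distributions with \<open>p \<le> \<lambda>\<^sup>2 q\<close>. There
  \<open>1 - \<Sum>\<^sub>i sqrt (p\<^sub>i q\<^sub>i) = \<Sum>\<^sub>i (p\<^sub>i - q\<^sub>i) sqrt p\<^sub>i / (sqrt p\<^sub>i + sqrt q\<^sub>i)\<close>; dropping the negative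
  summands and bounding the quotient by \<open>\<lambda> / (1 + \<lambda>)\<close> (by \<open>1\<close> if there is no such \<open>\<lambda>\<close>) leaves
  that constant times the sum of the positive parts of \<open>p\<^sub>i - q\<^sub>i\<close>, which is half of their \<open>l\<^sup>1\<close> norm.
\<close>

section \<open>The spectral theorem for Hermitian matrices\<close>

lemma dim_mat_adjoint [simp]:
  "dim_row (mat_adjoint A) = dim_col A" "dim_col (mat_adjoint A) = dim_row A"
  by (auto simp: mat_adjoint_def)

lemma mat_adjoint_index [simp]:
  "i < dim_col A \<Longrightarrow> j < dim_row A \<Longrightarrow> mat_adjoint A $$ (i, j) = conjugate (A $$ (j, i))"
  by (simp add: mat_adjoint_def mat_of_rows_index)

lemma mat_adjoint_carrier [simp]:
  "A \<in> carrier_mat n m \<Longrightarrow> mat_adjoint A \<in> carrier_mat m n"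
  by auto

lemma mat_adjoint_adjoint [simp]: "mat_adjoint (mat_adjoint A) = A"
  by (rule eq_matI) auto

lemma mat_adjoint_one [simp]: "mat_adjoint (1\<^sub>m n) = (1\<^sub>m n :: complex mat)"
  by (rule eq_matI) auto

lemma mat_adjoint_zero [simp]: "mat_adjoint (0\<^sub>m n m) = (0\<^sub>m m n :: complex mat)"
  by (rule eq_matI) auto

lemma mat_adjoint_mult:
  fixes A B :: "complex mat"
  assumes "A \<in> carrier_mat n m" "B \<in> carrier_mat m l"
  shows "mat_adjoint (A * B) = mat_adjoint B * mat_adjoint A"
  by (rule eq_matI) (use assms in \<open>auto simp: scalar_prod_def ac_simps\<close>)

lemma mat_adjoint_minus:
  fixes A B :: "complex mat"
  assumes "A \<in> carrier_mat n m" "B \<in> carrier_mat n m"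
  shows "mat_adjoint (A - B) = mat_adjoint A - mat_adjoint B"
  by (rule eq_matI) (use assms in auto)

lemma mat_adjoint_four_block:
  fixes A B C D :: "complex mat"
  assumes "A \<in> carrier_mat n m" "B \<in> carrier_mat n l" "C \<in> carrier_mat k m" "D \<in> carrier_mat k l"
  shows "mat_adjoint (four_block_mat A B C D) =
    four_block_mat (mat_adjoint A) (mat_adjoint C) (mat_adjoint B) (mat_adjoint D)"
  by (rule eq_matI) (use assms in auto)

lemma mult_mat_vec_cscalar:
  fixes A :: "complex mat"
  assumes "A \<in> carrier_mat n m" "v \<in> carrier_vec m" "w \<in> carrier_vec n"
  shows "(A *\<^sub>v v) \<bullet>c w = v \<bullet>c (mat_adjoint A *\<^sub>v w)"
proof -
  have "(A *\<^sub>v v) \<bullet>c w = (\<Sum>i<n. \<Sum>j<m. A $$ (i, j) * v $ j * cnj (w $ i))"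
    using assms by (simp add: scalar_prod_def sum_distrib_right atLeast0LessThan)
  also have "\<dots> = (\<Sum>j<m. \<Sum>i<n. A $$ (i, j) * v $ j * cnj (w $ i))"
    by (rule sum.swap)
  also have "\<dots> = v \<bullet>c (mat_adjoint A *\<^sub>v w)"
    using assms by (simp add: scalar_prod_def sum_distrib_left atLeast0LessThan ac_simps)
  finally show ?thesis .
qed

lemma cscalar_self: "v \<bullet>c v = complex_of_real (\<Sum>i<dim_vec v. (cmod (v $ i))\<^sup>2)"
  by (simp add: scalar_prod_def complex_norm_square atLeast0LessThan del: of_real_power)

section \<open>Unitary matrices and unitary diagonalisation\<close>

definition unitary_mat :: "nat \<Rightarrow> complex mat \<Rightarrow> bool" where
  "unitary_mat n U \<longleftrightarrow>
     U \<in> carrier_mat n n \<and> mat_adjoint U * U = 1\<^sub>m n \<and> U * mat_adjoint U = 1\<^sub>m n"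

lemma unitary_matI:
  assumes "U \<in> carrier_mat n n" "mat_adjoint U * U = 1\<^sub>m n"
  shows "unitary_mat n U"
  using assms mat_mult_left_right_inverse[of "mat_adjoint U" n U]
  by (auto simp: unitary_mat_def)

lemma unitary_mat_mult:
  assumes "unitary_mat n U" "unitary_mat n V"
  shows "unitary_mat n (U * V)"
proof (rule unitary_matI)
  have c: "U \<in> carrier_mat n n" "V \<in> carrier_mat n n" "mat_adjoint U \<in> carrier_mat n n"
    "mat_adjoint V \<in> carrier_mat n n"
    using assms by (auto simp: unitary_mat_def)
  then show "U * V \<in> carrier_mat n n" by auto
  have "mat_adjoint (U * V) * (U * V) = mat_adjoint V * (mat_adjoint U * U) * V"
    using c by (simp add: mat_adjoint_mult[of _ n n _ n] assoc_mult_mat[of _ n n _ n _ n]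
      mult_carrier_mat[of _ n n _ n])
  then show "mat_adjoint (U * V) * (U * V) = 1\<^sub>m n"
    using assms c by (simp add: unitary_mat_def)
qed

text \<open>Completing \<open>v\<close> to a basis, orthogonalising and normalising gives the
  columns of \<open>U\<close>; Gram-Schmidt keeps the first vector, so only its length changes. This
  provides the deflation step of the spectral theorem.\<close>

lemma unitary_first_column:
  fixes v :: "complex vec"
  assumes v: "v \<in> carrier_vec n" and v0: "v \<noteq> 0\<^sub>v n"
  obtains U c where "unitary_mat n U" "col U 0 = c \<cdot>\<^sub>v v"
proof -
  interpret cof_vec_space n "TYPE(complex)" .
  note bc = basis_completion[OF v v0]
  define ws where "ws = gram_schmidt n (basis_completion v)"
  from gram_schmidt_result[OF bc(2,4,5) ws_def]
  have ws: "set ws \<subseteq> carrier_vec n" "corthogonal ws" "length ws = n"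
    using bc(6) by auto
  have n: "0 < n"
    using v v0 by (cases n) auto
  obtain vs where "basis_completion v = v # vs"
    using bc(6,7) n by (cases "basis_completion v") auto
  then have hd: "ws ! 0 = v"
    using gram_schmidt_hd[OF v, of vs] ws(3) n by (metis hd_conv_nth length_0_conv less_irrefl ws_def)
  \<comment> \<open>The vectors in \<open>ws\<close> are orthogonal but not of unit length;
    \<open>r w\<close> is the reciprocal of the norm of \<open>w\<close>.\<close>
  define r where "r w = complex_of_real (1 / sqrt (\<Sum>i<dim_vec w. (cmod (w $ i))\<^sup>2))" for w :: "complex vec"
  define U where "U = mat_of_cols n (map (\<lambda>w. r w \<cdot>\<^sub>v w) ws)"
  have U: "U \<in> carrier_mat n n"
    using ws(3) mat_of_cols_carrier(1)[of n "map (\<lambda>w. r w \<cdot>\<^sub>v w) ws"] by (simp add: U_def)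
  have wsc: "ws ! i \<in> carrier_vec n" if "i < n" for i
    using that ws(1,3) by auto
  have col: "col U i = r (ws ! i) \<cdot>\<^sub>v ws ! i" if "i < n" for i
    using that ws(3) wsc[OF that] by (simp add: U_def)
  have "mat_adjoint U * U = 1\<^sub>m n"
  proof (rule eq_matI)
    fix i j assume ij: "i < dim_row (1\<^sub>m n :: complex mat)" "j < dim_col (1\<^sub>m n :: complex mat)"
    then have ij': "i < n" "j < n" by auto
    note c = wsc[OF ij'(1)] wsc[OF ij'(2)]
    have "(mat_adjoint U * U) $$ (i, j) = col U j \<bullet>c col U i"
      using U ij' by (simp add: scalar_prod_def ac_simps)
    also have "\<dots> = r (ws ! j) * r (ws ! i) * (ws ! j \<bullet>c ws ! i)"
      using c ij' by (simp add: col conjugate_smult_vec r_def)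
    also have "\<dots> = 1\<^sub>m n $$ (i, j)"
    proof (cases "i = j")
      case True
      define s where "s = (\<Sum>k<dim_vec (ws ! i). (cmod (ws ! i $ k))\<^sup>2)"
      have e: "ws ! i \<bullet>c ws ! i = complex_of_real s"
        by (simp only: s_def cscalar_self)
      have "ws ! i \<bullet>c ws ! i \<noteq> 0"
        using corthogonalD[OF ws(2), of i i] ij' ws(3) by auto
      moreover have "s \<ge> 0"
        by (simp add: s_def sum_nonneg)
      ultimately have "s > 0" using e by (cases "s = 0") auto
      then have "1 / sqrt s * (1 / sqrt s) * s = 1" by (simp add: field_simps)
      then have "r (ws ! i) * r (ws ! i) * complex_of_real s = 1"
        unfolding r_def s_def[symmetric] by (metis of_real_1 of_real_mult)
      then show ?thesis using True ij' e by simp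
    next
      case False
      then have "ws ! j \<bullet>c ws ! i = 0"
        using corthogonalD[OF ws(2), of j i] ij' ws(3) by auto
      then show ?thesis using False ij' by simp
    qed
    finally show "(mat_adjoint U * U) $$ (i, j) = 1\<^sub>m n $$ (i, j)" .
  qed (use U in auto)
  then have "unitary_mat n U"
    by (rule unitary_matI[OF U])
  moreover have "col U 0 = r v \<cdot>\<^sub>v v"
    using col[OF n] hd by simp
  ultimately show ?thesis by (rule that)
qed

text \<open>Real diagonal entries make the matrix Hermitian, and keeping them as a function
  \<open>f\<close> turns functional calculus into pointwise operations on \<open>f\<close>.\<close>

definition unitary_conj_diag :: "complex mat \<Rightarrow> (nat \<Rightarrow> real) \<Rightarrow> complex mat" where
  "unitary_conj_diag U f = U * mat_diag (dim_row U) (\<lambda>i. complex_of_real (f i)) * mat_adjoint U"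

text \<open>Induction on the dimension by deflation: in an orthonormal basis starting with an
  eigenvector the first column is diagonal, hermiticity clears the first row as well, and the
  remaining block is Hermitian of size \<open>n\<close>.\<close>

theorem hermitian_spectral:
  fixes A :: "complex mat"
  assumes "A \<in> carrier_mat n n" "mat_adjoint A = A"
  obtains U f where "unitary_mat n U" "A = unitary_conj_diag U f"
proof -
  have "\<exists>U f. unitary_mat n U \<and> A = unitary_conj_diag U f"
    using assms
  proof (induction n arbitrary: A)
    case 0
    have "unitary_mat 0 (1\<^sub>m 0)" by (simp add: unitary_mat_def)
    moreover have "A = unitary_conj_diag (1\<^sub>m 0) (\<lambda>_. 0)"
      using 0 by (intro eq_matI) (auto simp: unitary_conj_diag_def)
    ultimately show ?case by blast
  next
    case (Suc n)
    note A = Suc.prems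
    \<comment> \<open>Over the complex numbers the characteristic polynomial splits into
      \<open>Suc n\<close> linear factors, so there is at least one eigenvalue.\<close>
    obtain es where es: "char_poly A = (\<Prod>e\<leftarrow>es. [:- e, 1:])" "length es = Suc n"
      using char_poly_factorized[OF A(1)] by auto
    then obtain e es' where "es = e # es'" by (cases es) auto
    with es have "poly (char_poly A) e = 0" by simp
    then have "eigenvalue A e" using eigenvalue_root_char_poly[OF A(1)] by simp
    then obtain v where v: "v \<in> carrier_vec (Suc n)" "v \<noteq> 0\<^sub>v (Suc n)" "A *\<^sub>v v = e \<cdot>\<^sub>v v"
      using A by (auto simp: eigenvalue_def eigenvector_def)
    obtain W c where W: "unitary_mat (Suc n) W" "col W 0 = c \<cdot>\<^sub>v v"
      using unitary_first_column[OF v(1,2)] .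
    let ?m = "Suc n"
    have Wc: "W \<in> carrier_mat ?m ?m" "mat_adjoint W \<in> carrier_mat ?m ?m"
      and WW: "mat_adjoint W * W = 1\<^sub>m ?m" "W * mat_adjoint W = 1\<^sub>m ?m"
      using W(1) by (auto simp: unitary_mat_def)
    note mm = mult_carrier_mat[of _ ?m ?m _ ?m] assoc_mult_mat[of _ ?m ?m _ ?m _ ?m]
    define B where "B = mat_adjoint W * A * W"
    have B: "B \<in> carrier_mat ?m ?m" using Wc A by (auto simp: B_def)
    have Bh: "mat_adjoint B = B"
      using Wc A by (simp add: B_def mat_adjoint_mult[of _ ?m ?m _ ?m] mm)
    have AB: "A = W * B * mat_adjoint W"
    proof -
      have "W * B * mat_adjoint W = (W * mat_adjoint W) * A * (W * mat_adjoint W)"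
        using Wc A(1) by (simp add: B_def mm)
      then show ?thesis using A(1) by (simp add: WW)
    qed
    have col0: "col B 0 = e \<cdot>\<^sub>v unit_vec ?m 0"
    proof -
      have "col B 0 = mat_adjoint W *\<^sub>v (A *\<^sub>v col W 0)"
        using Wc A(1) by (simp add: B_def mm col_mult2[of _ ?m ?m _ ?m] del: col_mult)
      also have "A *\<^sub>v col W 0 = e \<cdot>\<^sub>v col W 0"
        using A(1) v by (simp add: W(2) mult_mat_vec[of _ ?m ?m] smult_smult_assoc ac_simps)
      also have "mat_adjoint W *\<^sub>v (e \<cdot>\<^sub>v col W 0) = e \<cdot>\<^sub>v (mat_adjoint W *\<^sub>v col W 0)"
        using Wc v(1) by (intro mult_mat_vec[of _ ?m ?m]) (auto simp: W(2))
      also have "mat_adjoint W *\<^sub>v col W 0 = col (mat_adjoint W * W) 0"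
        using Wc by (simp add: col_mult2[of _ ?m ?m _ ?m] del: col_mult)
      finally show ?thesis by (simp add: WW)
    qed
    have Bi0: "B $$ (i, 0) = (if i = 0 then e else 0)" if "i < ?m" for i
      using arg_cong[OF col0, of "\<lambda>x. x $ i"] B that by (simp add: unit_vec_def)
    have B0i: "B $$ (0, i) = cnj (B $$ (i, 0))" if "i < ?m" for i
      using arg_cong[OF Bh, of "\<lambda>x. x $$ (0, i)"] B that by simp
    \<comment> \<open>The corner entry of a Hermitian matrix is its own conjugate, so the eigenvalue
      is real.\<close>
    have "cnj e = e" using Bi0[of 0] B0i[of 0] by simp
    then obtain x where x: "e = complex_of_real x"
      by (metis Reals_cases Reals_cnj_iff)
    define C where "C = mat n n (\<lambda>(i, j). B $$ (Suc i, Suc j))"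
    have C: "C \<in> carrier_mat n n" by (simp add: C_def)
    have "mat_adjoint C = C"
    proof (rule eq_matI)
      fix i j assume "i < dim_row C" "j < dim_col C"
      then show "mat_adjoint C $$ (i, j) = C $$ (i, j)"
        using arg_cong[OF Bh, of "\<lambda>x. x $$ (Suc i, Suc j)"] B C by (simp add: C_def)
    qed (use C in auto)
    from Suc.IH[OF C this] obtain V f where V: "unitary_mat n V" "C = unitary_conj_diag V f"
      by blast
    have Vc: "V \<in> carrier_mat n n" "mat_adjoint V \<in> carrier_mat n n" "mat_adjoint V * V = 1\<^sub>m n"
      using V(1) by (auto simp: unitary_mat_def)
    \<comment> \<open>\<open>X\<close> leaves the eigenvector fixed and diagonalises the lower
      block, so \<open>W * X\<close> diagonalises \<open>A\<close>, with \<open>x\<close> put in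
      front of the eigenvalues of \<open>C\<close>.\<close>
    define X where "X = four_block_mat (1\<^sub>m 1) (0\<^sub>m 1 n) (0\<^sub>m n 1) V"
    define g where "g i = (case i of 0 \<Rightarrow> x | Suc j \<Rightarrow> f j)" for i
    have X: "X \<in> carrier_mat ?m ?m" using Vc by (auto simp: X_def)
    have adX: "mat_adjoint X = four_block_mat (1\<^sub>m 1) (0\<^sub>m 1 n) (0\<^sub>m n 1) (mat_adjoint V)"
      using Vc by (simp add: X_def mat_adjoint_four_block[of _ 1 1 _ n _ n])
    have "mat_adjoint X * X = 1\<^sub>m ?m"
      unfolding adX unfolding X_def using Vc four_block_one_mat[of 1 n]
      by (subst mult_four_block_mat[of _ 1 1 _ n _ n _ _ 1 _ n])
        (auto simp: left_mult_zero_mat[of _ n n] right_mult_zero_mat[of _ n n])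
    then have uX: "unitary_mat ?m X" by (rule unitary_matI[OF X])
    have D: "mat_diag ?m (\<lambda>i. complex_of_real (g i)) =
      four_block_mat (mat 1 1 (\<lambda>_. e)) (0\<^sub>m 1 n) (0\<^sub>m n 1) (mat_diag n (\<lambda>i. complex_of_real (f i)))"
      by (rule eq_matI) (auto simp: mat_diag_def g_def x split: nat.splits)
    have BB: "B = four_block_mat (mat 1 1 (\<lambda>_. e)) (0\<^sub>m 1 n) (0\<^sub>m n 1) C"
    proof (rule eq_matI)
      fix i j assume "i < dim_row (four_block_mat (mat 1 1 (\<lambda>_. e)) (0\<^sub>m 1 n) (0\<^sub>m n 1) C)"
        "j < dim_col (four_block_mat (mat 1 1 (\<lambda>_. e)) (0\<^sub>m 1 n) (0\<^sub>m n 1) C)"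
      then show "B $$ (i, j) = four_block_mat (mat 1 1 (\<lambda>_. e)) (0\<^sub>m 1 n) (0\<^sub>m n 1) C $$ (i, j)"
        using Bi0[of i] B0i[of j] Bi0[of j] by (auto simp: C_def)
    qed (use B C in auto)
    have "B = unitary_conj_diag X g"
    proof -
      have "X * mat_diag ?m (\<lambda>i. complex_of_real (g i)) = four_block_mat (mat 1 1 (\<lambda>_. e))
        (0\<^sub>m 1 n) (0\<^sub>m n 1) (V * mat_diag n (\<lambda>i. complex_of_real (f i)))"
        unfolding D unfolding X_def using Vc
        by (subst mult_four_block_mat[of _ 1 1 _ n _ n _ _ 1 _ n])
          (auto simp: left_mult_zero_mat[of _ n n] right_mult_zero_mat[of _ n n])
      then have "unitary_conj_diag X g = four_block_mat (mat 1 1 (\<lambda>_. e))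
        (0\<^sub>m 1 n) (0\<^sub>m n 1) (V * mat_diag n (\<lambda>i. complex_of_real (f i))) * mat_adjoint X"
        using X by (simp add: unitary_conj_diag_def)
      also have "\<dots> = B"
        unfolding adX BB V(2) using Vc
        by (subst mult_four_block_mat[of _ 1 1 _ n _ n _ _ 1 _ n])
          (auto simp: unitary_conj_diag_def left_mult_zero_mat[of _ n n] right_mult_zero_mat[of _ n n]
            mult_carrier_mat[of _ n n])
      finally show ?thesis by simp
    qed
    then have "A = W * (X * mat_diag ?m (\<lambda>i. complex_of_real (g i)) * mat_adjoint X) * mat_adjoint W"
      using AB X by (simp add: unitary_conj_diag_def)
    also have "\<dots> = unitary_conj_diag (W * X) g"
      using Wc X by (simp add: unitary_conj_diag_def mat_adjoint_mult[of _ ?m ?m _ ?m] mm)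
    finally show ?case
      using unitary_mat_mult[OF W(1) uX] by blast
  qed
  then show ?thesis using that by blast
qed

section \<open>Spectral calculus, traces and square roots\<close>

lemma unitary_matD:
  assumes "unitary_mat n U"
  shows "U \<in> carrier_mat n n" "mat_adjoint U \<in> carrier_mat n n" "dim_row U = n" "dim_col U = n"
    "mat_adjoint U * U = 1\<^sub>m n" "U * mat_adjoint U = 1\<^sub>m n"
  using assms by (auto simp: unitary_mat_def)

lemma unitary_col_carrier: "unitary_mat n U \<Longrightarrow> i < n \<Longrightarrow> col U i \<in> carrier_vec n"
  using unitary_matD(3)[of n U] by (auto intro: carrier_vecI)

context
  fixes n :: nat
begin

private lemmas sq = mult_carrier_mat[of _ n n _ n] assoc_mult_mat[of _ n n _ n _ n]
  left_mult_one_mat[of _ n n] right_mult_one_mat[of _ n n]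

text \<open>The rules \<open>sq\<close> nest products to the right, which hides a known product
  \<open>A * B\<close> behind a trailing factor \<open>C\<close>; this form rewrites it
  there.\<close>

private lemma absorb:
  fixes A B C D :: "complex mat"
  assumes "A * B = D" "A \<in> carrier_mat n n" "B \<in> carrier_mat n n" "C \<in> carrier_mat n n"
  shows "A * (B * C) = D * C"
  using assms(1) assoc_mult_mat[OF assms(2-4)] by simp

section \<open>Functional calculus in a fixed eigenbasis\<close>

lemma unitary_conj_diag_carrier [simp]:
  "unitary_mat n U \<Longrightarrow> unitary_conj_diag U f \<in> carrier_mat n n"
  using unitary_matD[of n U] by (auto simp: unitary_conj_diag_def sq)

lemma unitary_conj_diag_cong:
  assumes "unitary_mat n U" "\<And>i. i < n \<Longrightarrow> f i = g i"
  shows "unitary_conj_diag U f = unitary_conj_diag U g"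
proof -
  have "mat_diag n (\<lambda>i. complex_of_real (f i)) = mat_diag n (\<lambda>i. complex_of_real (g i))"
    using assms(2) by (intro eq_matI) (auto simp: mat_diag_def)
  then show ?thesis using unitary_matD(3)[OF assms(1)] by (simp add: unitary_conj_diag_def)
qed

lemma unitary_conj_diag_one: "unitary_mat n U \<Longrightarrow> unitary_conj_diag U (\<lambda>_. 1) = 1\<^sub>m n"
  using unitary_matD[of n U] by (simp add: unitary_conj_diag_def)

lemma unitary_conj_diag_adjoint:
  assumes "unitary_mat n U"
  shows "mat_adjoint (unitary_conj_diag U f) = unitary_conj_diag U f"
proof -
  have "mat_adjoint (mat_diag n (\<lambda>i. complex_of_real (f i))) = mat_diag n (\<lambda>i. complex_of_real (f i))"
    by (intro eq_matI) (auto simp: mat_diag_def)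
  then show ?thesis
    using unitary_matD[OF assms] by (simp add: unitary_conj_diag_def mat_adjoint_mult[of _ n n _ n] sq)
qed

lemma unitary_conj_diag_mult:
  assumes "unitary_mat n U"
  shows "unitary_conj_diag U f * unitary_conj_diag U g = unitary_conj_diag U (\<lambda>i. f i * g i)"
proof -
  let ?D = "\<lambda>f. mat_diag n (\<lambda>i. complex_of_real (f i))"
  note U = unitary_matD[OF assms]
  have "unitary_conj_diag U f * unitary_conj_diag U g =
    U * (?D f * ((mat_adjoint U * U) * (?D g * mat_adjoint U)))"
    using U(1-4) by (simp add: unitary_conj_diag_def sq)
  also have "\<dots> = U * ((?D f * ?D g) * mat_adjoint U)"
    using U(1-4) by (simp add: U(5) sq del: mat_diag_diag)
  also have "\<dots> = unitary_conj_diag U (\<lambda>i. f i * g i)"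
    using U(1-4) by (simp add: unitary_conj_diag_def sq)
  finally show ?thesis .
qed

lemma unitary_conj_diag_minus:
  assumes "unitary_mat n U"
  shows "unitary_conj_diag U f - unitary_conj_diag U g = unitary_conj_diag U (\<lambda>i. f i - g i)"
proof -
  let ?D = "\<lambda>f. mat_diag n (\<lambda>i. complex_of_real (f i))"
  note U = unitary_matD[OF assms]
  have "?D (\<lambda>i. f i - g i) = ?D f - ?D g"
    by (intro eq_matI) (auto simp: mat_diag_def)
  then show ?thesis
    using U by (simp add: unitary_conj_diag_def sq minus_mult_distrib_mat[of _ n n _ _ n]
      mult_minus_distrib_mat[of _ n n _ n])
qed

section \<open>Traces and quadratic forms\<close>

lemma mat_trace_mult_commute:
  assumes "A \<in> carrier_mat n n" "B \<in> carrier_mat n n"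
  shows "mat_trace (A * B) = mat_trace (B * A)"
proof -
  have "mat_trace (A * B) = (\<Sum>i<n. \<Sum>j<n. A $$ (i, j) * B $$ (j, i))"
    using assms by (simp add: mat_trace_def scalar_prod_def atLeast0LessThan)
  also have "\<dots> = (\<Sum>j<n. \<Sum>i<n. A $$ (i, j) * B $$ (j, i))"
    by (rule sum.swap)
  also have "\<dots> = mat_trace (B * A)"
    using assms by (simp add: mat_trace_def scalar_prod_def atLeast0LessThan mult.commute)
  finally show ?thesis .
qed

lemma mat_trace_minus:
  assumes "A \<in> carrier_mat n n" "B \<in> carrier_mat n n"
  shows "mat_trace (A - B) = mat_trace A - mat_trace B"
  using assms by (simp add: mat_trace_def sum_subtractf)

text \<open>For a density matrix and a unit vector \<open>v\<close> this is the probability of the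
  outcome \<open>v\<close> in a projective measurement. For Hermitian \<open>A\<close> the scalar
  product is already real.\<close>

definition qform :: "complex mat \<Rightarrow> complex vec \<Rightarrow> real" where
  "qform A v = Re ((A *\<^sub>v v) \<bullet>c v)"

lemma psd_mat_iff_qform:
  assumes "A \<in> carrier_mat n n"
  shows "psd_mat A \<longleftrightarrow> mat_adjoint A = A \<and> (\<forall>v \<in> carrier_vec n. 0 \<le> qform A v)"
  using assms by (auto simp: psd_mat_def qform_def)

lemma qform_minus:
  assumes "A \<in> carrier_mat n n" "B \<in> carrier_mat n n" "v \<in> carrier_vec n"
  shows "qform (A - B) v = qform A v - qform B v"
  using assms
  by (simp add: qform_def minus_mult_distrib_mat_vec[of _ n n] minus_scalar_prod_distrib[of _ n])

lemma qform_smult: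
  assumes "A \<in> carrier_mat n n" "v \<in> carrier_vec n"
  shows "qform (complex_of_real c \<cdot>\<^sub>m A) v = c * qform A v"
proof -
  have "(complex_of_real c \<cdot>\<^sub>m A) *\<^sub>v v = complex_of_real c \<cdot>\<^sub>v (A *\<^sub>v v)"
    using assms by (intro eq_vecI) auto
  then show ?thesis using assms by (simp add: qform_def)
qed

lemma qform_smult_vec:
  assumes "A \<in> carrier_mat n n" "v \<in> carrier_vec n"
  shows "qform A (complex_of_real c \<cdot>\<^sub>v v) = c\<^sup>2 * qform A v"
  using assms by (simp add: qform_def mult_mat_vec[of _ n n] conjugate_smult_vec power2_eq_square)

lemma qform_congruence:
  assumes "A \<in> carrier_mat n n" "B \<in> carrier_mat n n" "v \<in> carrier_vec n"
  shows "qform (mat_adjoint B * A * B) v = qform A (B *\<^sub>v v)"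
proof -
  have "(mat_adjoint B * A * B) *\<^sub>v v = mat_adjoint B *\<^sub>v (A *\<^sub>v (B *\<^sub>v v))"
    using assms by (simp add: sq assoc_mult_mat_vec[of _ n n _ n])
  then show ?thesis
    using assms by (simp add: qform_def mult_mat_vec_cscalar[of _ n n])
qed

lemma psd_mat_congruence:
  assumes "A \<in> carrier_mat n n" "B \<in> carrier_mat n n" "psd_mat A"
  shows "psd_mat (mat_adjoint B * A * B)"
proof -
  have "mat_adjoint (mat_adjoint B * A * B) = mat_adjoint B * A * B"
    using assms by (simp add: psd_mat_iff_qform sq mat_adjoint_mult[of _ n n _ n])
  moreover have "0 \<le> qform (mat_adjoint B * A * B) v" if "v \<in> carrier_vec n" for v
    using assms that by (simp only: qform_congruence) (simp add: psd_mat_iff_qform)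
  ultimately show ?thesis
    using assms by (simp add: psd_mat_iff_qform mult_carrier_mat[of _ n n _ n])
qed

text \<open>The trace is invariant under conjugation by \<open>V\<close>, and the diagonal entries
  in the new basis are the values of the form. For density matrices this says that outcome
  probabilities sum to one.\<close>

lemma qform_trace:
  assumes "A \<in> carrier_mat n n" "unitary_mat n V"
  shows "Re (mat_trace A) = (\<Sum>i<n. qform A (col V i))"
proof -
  note V = unitary_matD[OF assms(2)]
  have "mat_trace A = mat_trace ((A * V) * mat_adjoint V)"
    using assms(1) V by (simp add: sq)
  also have "\<dots> = mat_trace (mat_adjoint V * (A * V))"
    using assms(1) V by (intro mat_trace_mult_commute) (auto simp: sq)
  also have "\<dots> = (\<Sum>i<n. (A *\<^sub>v col V i) \<bullet>c col V i)"
    unfolding mat_trace_def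
  proof (rule sum.cong)
    fix i assume "i \<in> {..<n}"
    then have i: "i < n" by simp
    have "(mat_adjoint V * (A * V)) $$ (i, i) = row (mat_adjoint V) i \<bullet> (A *\<^sub>v col V i)"
      using V assms(1) i by (simp add: col_mult2[of _ n n _ n] del: col_mult)
    also have "row (mat_adjoint V) i = conjugate (col V i)"
      using V i by (intro eq_vecI) auto
    also have "conjugate (col V i) \<bullet> (A *\<^sub>v col V i) = (A *\<^sub>v col V i) \<bullet>c col V i"
      using V assms(1) i by (intro comm_scalar_prod[of _ n]) auto
    finally show "(mat_adjoint V * (A * V)) $$ (i, i) = (A *\<^sub>v col V i) \<bullet>c col V i" .
  qed (use V in auto)
  finally show ?thesis by (simp add: qform_def)
qed

lemma unitary_conj_diag_col:
  assumes "unitary_mat n U" "i < n"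
  shows "unitary_conj_diag U f *\<^sub>v col U i = complex_of_real (f i) \<cdot>\<^sub>v col U i"
proof -
  let ?D = "mat_diag n (\<lambda>i. complex_of_real (f i))"
  note U = unitary_matD[OF assms(1)]
  have "unitary_conj_diag U f *\<^sub>v col U i = col (unitary_conj_diag U f * U) i"
    using U assms(2) by (intro col_mult2[symmetric, of _ n n _ n]) (auto simp: assms(1))
  also have "unitary_conj_diag U f * U = U * ?D"
    using U by (simp add: unitary_conj_diag_def sq)
  also have "col (U * ?D) i = complex_of_real (f i) \<cdot>\<^sub>v col U i"
    using U assms(2) by (intro eq_vecI) (auto simp: mat_diag_mult_right[of _ n n])
  finally show ?thesis .
qed

lemma cscalar_unitary_col:
  assumes "unitary_mat n U" "i < n"
  shows "col U i \<bullet>c col U i = 1"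
proof -
  note U = unitary_matD[OF assms(1)]
  have "col U i \<bullet>c col U i = (mat_adjoint U * U) $$ (i, i)"
    using U(1-4) assms(2) by (simp add: scalar_prod_def ac_simps)
  then show ?thesis using U assms by simp
qed

lemma qform_unitary_conj_diag:
  assumes "unitary_mat n U" "v \<in> carrier_vec n"
  shows "qform (unitary_conj_diag U f) v = (\<Sum>i<n. f i * (cmod ((mat_adjoint U *\<^sub>v v) $ i))\<^sup>2)"
proof -
  let ?D = "mat_diag n (\<lambda>i. complex_of_real (f i))"
  define w where "w = mat_adjoint U *\<^sub>v v"
  note U = unitary_matD[OF assms(1)]
  have w: "w \<in> carrier_vec n" using U assms by (simp add: w_def mult_mat_vec_carrier[of _ n n])
  have "unitary_conj_diag U f = mat_adjoint (mat_adjoint U) * ?D * mat_adjoint U"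
    using U by (simp add: unitary_conj_diag_def)
  then have "qform (unitary_conj_diag U f) v = qform ?D w"
    using qform_congruence[of ?D "mat_adjoint U" v] U assms by (simp add: w_def)
  also have "?D *\<^sub>v w = vec n (\<lambda>i. complex_of_real (f i) * w $ i)"
    using w by (intro eq_vecI) (auto simp: mat_diag_def scalar_prod_def if_distrib[where f="\<lambda>x. x * _"] cong: if_cong)
  then have "qform ?D w = (\<Sum>i<n. f i * (cmod (w $ i))\<^sup>2)"
    using w unfolding qform_def cmod_power2
    by (simp add: scalar_prod_def power2_eq_square atLeast0LessThan algebra_simps sum.distrib)
  finally show ?thesis by (simp add: w_def)
qed

section \<open>Positive semidefinite matrices and their square roots\<close>

lemma psd_unitary_conj_diag:
  assumes "unitary_mat n U" "\<And>i. i < n \<Longrightarrow> 0 \<le> f i"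
  shows "psd_mat (unitary_conj_diag U f)"
  using assms
  by (auto simp: psd_mat_iff_qform unitary_conj_diag_adjoint qform_unitary_conj_diag intro!: sum_nonneg)

text \<open>Each eigenvalue is the value of the form at the corresponding unit eigenvector, hence
  nonnegative.\<close>

lemma psd_spectral:
  assumes "A \<in> carrier_mat n n" "psd_mat A"
  obtains U f where "unitary_mat n U" "\<And>i. i < n \<Longrightarrow> 0 \<le> f i" "A = unitary_conj_diag U f"
proof -
  obtain U f where U: "unitary_mat n U" and A: "A = unitary_conj_diag U f"
    using hermitian_spectral[of A n] assms by (auto simp: psd_mat_iff_qform)
  have "0 \<le> f i" if "i < n" for i
  proof -
    have c: "col U i \<in> carrier_vec n" using U that by (rule unitary_col_carrier)
    then have "0 \<le> qform A (col U i)" using assms by (auto simp: psd_mat_iff_qform)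
    also have "\<dots> = f i"
      using c by (simp add: A qform_def unitary_conj_diag_col[OF U that] cscalar_unitary_col[OF U that])
    finally show ?thesis .
  qed
  with U A show ?thesis using that by blast
qed

text \<open>Uniqueness of the square root, on which the description in \<open>mat_sqrt\<close>
  rests. The change of basis \<open>W\<close> between the two eigenbases intertwines the squared
  eigenvalues, so an entry of \<open>W\<close> can be nonzero only where \<open>s i\<close> and
  \<open>t j\<close> have equal squares. Being nonnegative they then agree, so \<open>W\<close>
  intertwines the eigenvalues themselves.\<close>

lemma psd_square_inj:
  assumes "S \<in> carrier_mat n n" "T \<in> carrier_mat n n" "psd_mat S" "psd_mat T" "S * S = T * T"
  shows "S = T"
proof -
  let ?D = "\<lambda>f. mat_diag n (\<lambda>i. complex_of_real (f i))"
  obtain U s where U: "unitary_mat n U" "\<And>i. i < n \<Longrightarrow> 0 \<le> s i" and S: "S = unitary_conj_diag U s"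
    using psd_spectral[OF assms(1,3)] by blast
  obtain V t where V: "unitary_mat n V" "\<And>i. i < n \<Longrightarrow> 0 \<le> t i" and T: "T = unitary_conj_diag V t"
    using psd_spectral[OF assms(2,4)] by blast
  note u = unitary_matD[OF U(1)] and v = unitary_matD[OF V(1)]
  define W where "W = mat_adjoint U * V"
  have W: "W \<in> carrier_mat n n" using u v by (simp add: W_def sq)
  have "?D (\<lambda>i. s i * s i) * W = mat_adjoint U * unitary_conj_diag U (\<lambda>i. s i * s i) * V"
    using u v by (simp add: W_def unitary_conj_diag_def sq absorb[OF u(5)])
  also have "\<dots> = mat_adjoint U * unitary_conj_diag V (\<lambda>i. t i * t i) * V"
    using assms(5) by (simp add: S T unitary_conj_diag_mult U(1) V(1))
  also have "\<dots> = W * ?D (\<lambda>i. t i * t i)"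
    using u v by (simp add: W_def unitary_conj_diag_def sq)
  finally have eq: "?D (\<lambda>i. s i * s i) * W = W * ?D (\<lambda>i. t i * t i)" .
  have "?D s * W = W * ?D t"
  proof (rule eq_matI)
    fix i j assume "i < dim_row (W * ?D t)" "j < dim_col (W * ?D t)"
    then have ij: "i < n" "j < n" using W by (auto simp: mat_diag_def)
    have "complex_of_real (s i * s i) * W $$ (i, j) = W $$ (i, j) * complex_of_real (t j * t j)"
      using arg_cong[OF eq, of "\<lambda>x. x $$ (i, j)"] W ij
      by (simp add: mat_diag_mult_left[of _ n n] mat_diag_mult_right[of _ n n])
    then have "W $$ (i, j) = 0 \<or> complex_of_real (s i * s i) = complex_of_real (t j * t j)"
      by auto
    then have "W $$ (i, j) = 0 \<or> s i = t j"
      using U(2)[OF ij(1)] V(2)[OF ij(2)]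
      by (metis abs_of_nonneg of_real_eq_iff power2_eq_square real_sqrt_abs)
    then show "(?D s * W) $$ (i, j) = (W * ?D t) $$ (i, j)"
      using W ij by (auto simp: mat_diag_mult_left[of _ n n] mat_diag_mult_right[of _ n n])
  qed (use W in \<open>auto simp: mat_diag_def\<close>)
  then have "U * (?D s * W) * mat_adjoint V = U * (W * ?D t) * mat_adjoint V"
    by simp
  moreover have "U * (?D s * W) * mat_adjoint V = S"
    using u v by (simp add: W_def S unitary_conj_diag_def sq)
  moreover have "U * (W * ?D t) * mat_adjoint V = T"
    using u v by (simp add: W_def T unitary_conj_diag_def sq absorb[OF u(6)])
  ultimately show ?thesis by simp
qed

lemma mat_sqrt_eqI:
  assumes "S \<in> carrier_mat n n" "psd_mat S" "S * S = A"
  shows "mat_sqrt A = S"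
  unfolding mat_sqrt_def
proof (rule the_equality)
  fix T assume T: "psd_mat T \<and> T * T = A"
  \<comment> \<open>The description leaves the size of \<open>T\<close> open; it is recovered from
    the number of rows of \<open>T * T\<close>.\<close>
  then have "T \<in> carrier_mat n n"
    using assms by (auto simp: psd_mat_def dest!: arg_cong[of _ _ dim_row])
  then show "T = S" using psd_square_inj[of T S] assms T by simp
qed (use assms in auto)

lemma mat_sqrt_unitary_conj_diag:
  assumes "unitary_mat n U" "\<And>i. i < n \<Longrightarrow> 0 \<le> f i"
  shows "mat_sqrt (unitary_conj_diag U f) = unitary_conj_diag U (\<lambda>i. sqrt (f i))"
proof (rule mat_sqrt_eqI)
  show "unitary_conj_diag U (\<lambda>i. sqrt (f i)) * unitary_conj_diag U (\<lambda>i. sqrt (f i)) =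
    unitary_conj_diag U f"
    using assms by (auto simp: unitary_conj_diag_mult intro!: unitary_conj_diag_cong)
qed (use assms in \<open>auto intro!: psd_unitary_conj_diag\<close>)

lemma mat_sqrt_psd:
  assumes "A \<in> carrier_mat n n" "psd_mat A"
  shows "mat_sqrt A \<in> carrier_mat n n" "psd_mat (mat_sqrt A)" "mat_sqrt A * mat_sqrt A = A"
proof -
  obtain U f where U: "unitary_mat n U" "\<And>i. i < n \<Longrightarrow> 0 \<le> f i" and A: "A = unitary_conj_diag U f"
    using psd_spectral[OF assms] by blast
  have s: "mat_sqrt A = unitary_conj_diag U (\<lambda>i. sqrt (f i))"
    unfolding A using U by (rule mat_sqrt_unitary_conj_diag)
  show "mat_sqrt A \<in> carrier_mat n n" "psd_mat (mat_sqrt A)"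
    using U by (auto simp: s intro!: psd_unitary_conj_diag)
  show "mat_sqrt A * mat_sqrt A = A"
    unfolding s unfolding A
    using U by (auto simp: unitary_conj_diag_mult intro!: unitary_conj_diag_cong)
qed

text \<open>A measurement cannot increase the trace norm: by the triangle inequality in the
  eigenbasis of \<open>A\<close>, its form is bounded in modulus by that of the absolute value
  \<open>?B\<close>, and summing the latter over an orthonormal basis gives its trace.\<close>

lemma sum_abs_qform_le_trace_norm:
  assumes "A \<in> carrier_mat n n" "mat_adjoint A = A" "unitary_mat n V"
  shows "(\<Sum>i<n. \<bar>qform A (col V i)\<bar>) \<le> trace_norm A"
proof -
  obtain U f where U: "unitary_mat n U" and A: "A = unitary_conj_diag U f"
    using hermitian_spectral[OF assms(1,2)] by blast
  let ?B = "unitary_conj_diag U (\<lambda>i. \<bar>f i\<bar>)"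
  have "mat_sqrt (A * A) = ?B"
    using U by (intro mat_sqrt_eqI) (auto simp: A unitary_conj_diag_mult intro!: psd_unitary_conj_diag)
  then have "trace_norm A = (\<Sum>i<n. qform ?B (col V i))"
    using qform_trace[OF _ assms(3), of ?B] U by (simp add: trace_norm_def)
  moreover have "\<bar>qform A v\<bar> \<le> qform ?B v" if "v \<in> carrier_vec n" for v
    unfolding A qform_unitary_conj_diag[OF U that]
    by (rule order_trans[OF sum_abs]) (simp add: abs_mult)
  ultimately show ?thesis
    using unitary_col_carrier[OF assms(3)] by (auto intro!: sum_mono)
qed

section \<open>The Fuchs-Caves measurement\<close>

private lemma zero_mat_mult_vec:
  fixes v :: "complex vec"
  assumes "v \<in> carrier_vec n"
  shows "0\<^sub>m n n *\<^sub>v v = 0\<^sub>v n"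
  using assms by (intro eq_vecI) auto

text \<open>The diagonal entries of \<open>mat_adjoint Z * Z\<close> are the squared norms of the
  columns of \<open>Z\<close>.\<close>

lemma mat_adjoint_mult_self_eq_0:
  fixes Z :: "complex mat"
  assumes "Z \<in> carrier_mat n n" "mat_adjoint Z * Z = 0\<^sub>m n n"
  shows "Z = 0\<^sub>m n n"
proof (rule eq_matI)
  fix i j assume "i < dim_row (0\<^sub>m n n :: complex mat)" "j < dim_col (0\<^sub>m n n :: complex mat)"
  then have ij: "i < n" "j < n" by auto
  have "col Z j \<bullet>c col Z j = (mat_adjoint Z * Z) $$ (j, j)"
    using assms(1) ij by (simp add: scalar_prod_def ac_simps)
  then have "col Z j \<bullet>c col Z j = 0"
    using assms(2) ij by simp
  then have "col Z j = 0\<^sub>v n"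
    using assms(1) by (subst (asm) conjugate_square_eq_0_vec[of _ n]) (auto intro: carrier_vecI)
  moreover have "Z $$ (i, j) = col Z j $ i"
    using assms(1) ij by simp
  ultimately show "Z $$ (i, j) = 0\<^sub>m n n $$ (i, j)"
    using ij by simp
qed (use assms in auto)

text \<open>
  The measurement basis diagonalises \<open>M = \<rho>\<^sup>-\<^sup>1\<^sup>/\<^sup>2 (\<rho>\<^sup>1\<^sup>/\<^sup>2 \<sigma> \<rho>\<^sup>1\<^sup>/\<^sup>2)\<^sup>1\<^sup>/\<^sup>2 \<rho>\<^sup>-\<^sup>1\<^sup>/\<^sup>2\<close>, where the inverse root is the
  pseudo-inverse \<open>K\<close>: it inverts \<open>\<rho>\<^sup>1\<^sup>/\<^sup>2\<close> on the support of \<open>\<rho>\<close> and, as \<open>1 / 0 = 0\<close>, vanishes on the kernel.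
\<close>

theorem fuchs_caves_measurement:
  assumes "\<rho> \<in> carrier_mat n n" "\<sigma> \<in> carrier_mat n n" "psd_mat \<rho>" "psd_mat \<sigma>"
  obtains V where "unitary_mat n V"
    "fidelity \<rho> \<sigma> = (\<Sum>i<n. sqrt (qform \<rho> (col V i) * qform \<sigma> (col V i)))"
proof -
  obtain U r where U: "unitary_mat n U" and r: "\<And>i. i < n \<Longrightarrow> 0 \<le> r i"
    and rho: "\<rho> = unitary_conj_diag U r"
    using psd_spectral[OF assms(1,3)] by blast
  define R where "R = unitary_conj_diag U (\<lambda>i. sqrt (r i))"
  define K where "K = unitary_conj_diag U (\<lambda>i. 1 / sqrt (r i))"
  \<comment> \<open>\<open>P\<close> and \<open>Q\<close> are the orthogonal projections onto the
    support and the kernel of \<open>\<rho>\<close>.\<close>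
  define P where "P = unitary_conj_diag U (\<lambda>i. if r i = 0 then 0 else 1)"
  define Q where "Q = unitary_conj_diag U (\<lambda>i. if r i = 0 then 1 else 0)"
  have sqrt_rho: "mat_sqrt \<rho> = R"
    unfolding rho R_def using U r by (rule mat_sqrt_unitary_conj_diag)
  have car: "R \<in> carrier_mat n n" "K \<in> carrier_mat n n" "P \<in> carrier_mat n n" "Q \<in> carrier_mat n n"
    using U by (auto simp: R_def K_def P_def Q_def)
  have adj: "mat_adjoint R = R" "mat_adjoint K = K" "mat_adjoint P = P" "mat_adjoint Q = Q"
    using U by (auto simp: R_def K_def P_def Q_def unitary_conj_diag_adjoint)
  have zero: "unitary_conj_diag U (\<lambda>_. 0) = 0\<^sub>m n n"
    using unitary_conj_diag_minus[OF U, of "\<lambda>_. 1" "\<lambda>_. 1"] U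
    by (simp add: minus_r_inv_mat[of _ n n])
  \<comment> \<open>All these factors are diagonal in the basis \<open>U\<close>, so each identity
    reduces to one between real numbers, with the case \<open>r i = 0\<close> treated
    separately.\<close>
  have KR: "K * R = P" and RK: "R * K = P" and KrhoK: "K * (\<rho> * K) = P"
    using U r by (auto simp: K_def R_def P_def rho unitary_conj_diag_mult intro!: unitary_conj_diag_cong)
  have PK: "P * K = K" and PQ1: "P = 1\<^sub>m n - Q" and QQ: "Q * Q = Q"
    using U by (auto simp: K_def P_def Q_def unitary_conj_diag_mult unitary_conj_diag_minus
        unitary_conj_diag_one[OF U, symmetric] intro!: unitary_conj_diag_cong)
  have QK: "Q * K = 0\<^sub>m n n" and RQ: "R * Q = 0\<^sub>m n n" and rhoQ: "\<rho> * Q = 0\<^sub>m n n"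
    and PQ: "P * Q = 0\<^sub>m n n"
    using U by (auto simp: K_def R_def P_def Q_def rho unitary_conj_diag_mult
        zero[symmetric] intro!: unitary_conj_diag_cong)
  define X where "X = R * \<sigma> * R"
  have X: "X \<in> carrier_mat n n" "psd_mat X"
    using psd_mat_congruence[OF assms(2) car(1) assms(4)] car assms by (auto simp: X_def adj sq)
  define T where "T = mat_sqrt X"
  have T: "T \<in> carrier_mat n n" "psd_mat T" "T * T = X"
    using mat_sqrt_psd[OF X] by (auto simp: T_def)
  have adjT: "mat_adjoint T = T" using T by (simp add: psd_mat_iff_qform)
  have fid: "fidelity \<rho> \<sigma> = Re (mat_trace T)"
    by (simp add: fidelity_def sqrt_rho T_def X_def)
  \<comment> \<open>The square of \<open>T\<close> is \<open>X\<close>, which vanishes on the kernel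
    of \<open>\<rho>\<close>; hence so does \<open>T\<close>, and it is supported on
    \<open>P\<close> from both sides.\<close>
  have TQ: "T * Q = 0\<^sub>m n n"
  proof (rule mat_adjoint_mult_self_eq_0)
    have "mat_adjoint (T * Q) * (T * Q) = Q * ((T * T) * Q)"
      using T(1) car by (simp add: mat_adjoint_mult[of _ n n _ n] adj adjT sq)
    also have "\<dots> = Q * R * \<sigma> * (R * Q)"
      using car assms by (simp add: T(3) X_def sq)
    also have "\<dots> = 0\<^sub>m n n"
      using car assms by (simp add: RQ sq)
    finally show "mat_adjoint (T * Q) * (T * Q) = 0\<^sub>m n n" .
  qed (use T car in \<open>auto simp: sq\<close>)
  have "T - 0\<^sub>m n n = T"
    using T(1) by (intro eq_matI) auto
  then have TP: "T * P = T"
    using T(1) car by (simp add: PQ1 mult_minus_distrib_mat[of _ n n _ n] sq TQ)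
  have PT: "P * T = T"
    using arg_cong[OF TP, of mat_adjoint] T(1) car by (simp add: mat_adjoint_mult[of _ n n _ n] adj adjT)
  define M where "M = K * (T * K)"
  have M: "M \<in> carrier_mat n n" "psd_mat M"
    using psd_mat_congruence[OF T(1) car(2) T(2)] car T by (auto simp: M_def adj sq)
  have adjM: "mat_adjoint M = M" using M by (simp add: psd_mat_iff_qform)
  have QM: "Q * M = 0\<^sub>m n n" and PM: "P * M = M"
    using car T(1) by (auto simp: M_def sq absorb[OF QK] absorb[OF PK])
  \<comment> \<open>\<open>M\<close> carries \<open>\<rho>\<close> to the part of
    \<open>\<sigma>\<close> on the support of \<open>\<rho>\<close>: the inner
    \<open>K * (\<rho> * K)\<close> is absorbed by \<open>T\<close>, and \<open>T * T\<close>
    restores \<open>\<sigma>\<close> between two copies of \<open>R\<close>, which \<open>K\<close>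
    cancels to \<open>P\<close>.\<close>
  have MrhoM: "M * \<rho> * M = P * \<sigma> * P"
  proof -
    have "M * \<rho> * M = K * (T * ((K * (\<rho> * K)) * (T * K)))"
      using car T(1) assms(1) by (simp add: M_def sq)
    also have "\<dots> = K * ((T * T) * K)"
      using car T(1) by (simp add: KrhoK sq absorb[OF PT])
    also have "\<dots> = (K * R) * \<sigma> * (R * K)"
      using car assms(2) unfolding T(3) by (simp add: X_def sq)
    finally show ?thesis by (simp add: KR RK)
  qed
  have trace: "mat_trace (\<rho> * M) = mat_trace T"
  proof -
    have "mat_trace (\<rho> * M) = mat_trace ((\<rho> * (K * T)) * K)"
      using car T(1) assms(1) by (simp add: M_def sq)
    also have "\<dots> = mat_trace (K * (\<rho> * (K * T)))"
      using car T(1) assms(1) by (intro mat_trace_mult_commute) (auto simp: sq)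
    also have "K * (\<rho> * (K * T)) = (K * (\<rho> * K)) * T"
      using car T(1) assms(1) by (simp add: sq)
    finally show ?thesis by (simp add: KrhoK PT)
  qed
  \<comment> \<open>Subtracting \<open>Q\<close> separates the kernel of \<open>\<rho>\<close> (eigenvalue \<open>-1\<close>) from its support
    (eigenvalues \<open>\<ge> 0\<close>), so that each eigenvector below lies in one of them.\<close>
  define N where "N = M - Q"
  have N: "N \<in> carrier_mat n n" "mat_adjoint N = N"
    using M car by (auto simp: N_def mat_adjoint_minus[of _ n n] adjM adj)
  obtain V m where V: "unitary_mat n V" and NV: "N = unitary_conj_diag V m"
    using hermitian_spectral[OF N] by blast
  \<comment> \<open>Write \<open>p\<close>, \<open>q\<close> for the two outcome probabilities. On
    the support \<open>v\<close> is an eigenvector of \<open>M\<close>, so \<open>MrhoM\<close>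
    gives \<open>q = (m i)^2 * p\<close> and the root is \<open>m i * p\<close>. In the other case
    \<open>p = 0\<close> and both sides vanish.\<close>
  have sqrt_eq: "sqrt (qform \<rho> (col V i) * qform \<sigma> (col V i)) = qform (\<rho> * N) (col V i)"
    if i: "i < n" for i
  proof -
    define v where "v = col V i"
    have v: "v \<in> carrier_vec n" using unitary_col_carrier[OF V i] by (simp add: v_def)
    have ev: "N *\<^sub>v v = complex_of_real (m i) \<cdot>\<^sub>v v"
      using unitary_conj_diag_col[OF V i] by (simp add: NV v_def)
    have MQv: "M *\<^sub>v v - Q *\<^sub>v v = complex_of_real (m i) \<cdot>\<^sub>v v"
      using ev M car v by (simp add: N_def minus_mult_distrib_mat_vec[of _ n n])
    have p: "0 \<le> qform \<rho> v"
      using assms v by (simp add: psd_mat_iff_qform)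
    have "(\<rho> * N) *\<^sub>v v = complex_of_real (m i) \<cdot>\<^sub>v (\<rho> *\<^sub>v v)"
      using assms(1) N(1) v by (simp add: assoc_mult_mat_vec[of _ n n _ n] ev mult_mat_vec[of _ n n])
    then have rhs: "qform (\<rho> * N) v = m i * qform \<rho> v"
      using assms(1) v by (simp add: qform_def)
    show ?thesis
    proof (cases "0 \<le> m i")
      case True
      \<comment> \<open>Applying \<open>Q\<close> to the eigenvalue equation shows that
        \<open>Q *\<^sub>v v\<close> is multiplied by both \<open>m i\<close> and \<open>-1\<close>;
        as \<open>m i\<close> is nonnegative, it must be zero.\<close>
      have "complex_of_real (m i) \<cdot>\<^sub>v (Q *\<^sub>v v) = Q *\<^sub>v (M *\<^sub>v v - Q *\<^sub>v v)"
        using car v by (simp add: MQv mult_mat_vec[of _ n n])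
      also have "\<dots> = (Q * M) *\<^sub>v v - (Q * Q) *\<^sub>v v"
        using car M v by (simp add: mult_minus_distrib_mat_vec[of _ n n] assoc_mult_mat_vec[of _ n n _ n])
      finally have e: "complex_of_real (m i) \<cdot>\<^sub>v (Q *\<^sub>v v) = 0\<^sub>m n n *\<^sub>v v - Q *\<^sub>v v"
        by (simp add: QM QQ)
      have Qv: "Q *\<^sub>v v = 0\<^sub>v n"
      proof (rule eq_vecI)
        fix k assume "k < dim_vec (0\<^sub>v n :: complex vec)"
        then have k: "k < n" by simp
        have "complex_of_real (m i) * (Q *\<^sub>v v) $ k = - (Q *\<^sub>v v) $ k"
          using arg_cong[OF e, of "\<lambda>x. x $ k"] k car(4) unfolding zero_mat_mult_vec[OF v]
          by (simp del: index_mult_mat_vec)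
        then have "complex_of_real (m i + 1) * (Q *\<^sub>v v) $ k = 0"
          by (simp add: algebra_simps)
        then show "(Q *\<^sub>v v) $ k = 0\<^sub>v n $ k"
          using True k unfolding mult_eq_0_iff of_real_eq_0_iff by auto
      qed (use car in auto)
      have Pv: "P *\<^sub>v v = v"
        using car v by (simp add: PQ1 minus_mult_distrib_mat_vec[of _ n n] Qv)
      have Mv: "M *\<^sub>v v = complex_of_real (m i) \<cdot>\<^sub>v v"
        using MQv M v by (simp add: Qv mult_mat_vec_carrier[of _ n n])
      have "qform \<sigma> v = qform (mat_adjoint P * \<sigma> * P) v"
        using car assms v by (simp add: qform_congruence Pv)
      also have "\<dots> = qform (mat_adjoint M * \<rho> * M) v"
        unfolding adj adjM MrhoM ..
      also have "\<dots> = (m i)\<^sup>2 * qform \<rho> v"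
        using M assms v by (simp add: qform_congruence Mv qform_smult_vec)
      finally have "qform \<rho> v * qform \<sigma> v = (m i * qform \<rho> v)\<^sup>2"
        by (simp add: power2_eq_square)
      then show ?thesis using True p rhs by (simp add: v_def)
    next
      case False
      \<comment> \<open>Applying \<open>P\<close> instead and pairing with \<open>v\<close> gives
        \<open>qform M v = m i * qform P v\<close>. Positivity of \<open>M\<close> and
        \<open>m i < 0\<close> leave no room for a component of \<open>v\<close> in the support of
        \<open>\<rho>\<close>.\<close>
      have "complex_of_real (m i) \<cdot>\<^sub>v (P *\<^sub>v v) = P *\<^sub>v (M *\<^sub>v v - Q *\<^sub>v v)"
        using car v by (simp add: MQv mult_mat_vec[of _ n n])
      also have "\<dots> = (P * M) *\<^sub>v v - (P * Q) *\<^sub>v v"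
        using car M v by (simp add: mult_minus_distrib_mat_vec[of _ n n] assoc_mult_mat_vec[of _ n n _ n])
      also have "\<dots> = M *\<^sub>v v"
        using M v by (simp add: PM PQ zero_mat_mult_vec mult_mat_vec_carrier[of _ n n])
      finally have "qform M v = Re ((complex_of_real (m i) \<cdot>\<^sub>v (P *\<^sub>v v)) \<bullet>c v)"
        by (simp add: qform_def)
      then have "qform M v = m i * qform P v"
        using car v by (simp add: qform_def)
      moreover have "0 \<le> qform M v" using M v by (simp add: psd_mat_iff_qform)
      ultimately have "qform P v \<le> 0" using False by (simp add: zero_le_mult_iff)
      let ?w = "\<lambda>k. (cmod ((mat_adjoint U *\<^sub>v v) $ k))\<^sup>2"
      have "(\<Sum>k<n. (if r k = 0 then 0 else 1) * ?w k) = 0"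
        using \<open>qform P v \<le> 0\<close> unfolding P_def qform_unitary_conj_diag[OF U v]
        by (intro antisym sum_nonneg) auto
      then have "\<forall>k<n. (if r k = 0 then 0 else 1) * ?w k = 0"
        by (subst (asm) sum_nonneg_eq_0_iff) auto
      then have "\<forall>k<n. r k * ?w k = 0" by (auto split: if_splits)
      then have "qform \<rho> v = 0"
        unfolding rho qform_unitary_conj_diag[OF U v] by (intro sum.neutral) auto
      then show ?thesis using rhs by (simp add: v_def)
    qed
  qed
  \<comment> \<open>Summing over the basis gives the trace of \<open>\<rho> * N\<close>; the
    correction \<open>Q\<close> drops out because \<open>\<rho> * Q\<close> is zero, leaving the
    trace of \<open>T\<close>.\<close>
  have "(\<Sum>i<n. sqrt (qform \<rho> (col V i) * qform \<sigma> (col V i))) = Re (mat_trace (\<rho> * N))"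
    using qform_trace[OF _ V, of "\<rho> * N"] assms(1) N(1) by (simp add: sqrt_eq sq)
  also have "\<rho> * N = \<rho> * M - \<rho> * Q"
    using assms(1) M car by (simp add: N_def mult_minus_distrib_mat[of _ n n _ n])
  also have "Re (mat_trace (\<rho> * M - \<rho> * Q)) = fidelity \<rho> \<sigma>"
    using assms(1) M by (simp add: rhoQ mat_trace_minus sq trace fid) (simp add: mat_trace_def)
  finally show ?thesis using that[OF V] by simp
qed

end

section \<open>The fidelity bound\<close>

lemma density_matD:
  assumes "density_mat d \<rho>"
  shows "\<rho> \<in> carrier_mat d d" "psd_mat \<rho>" "mat_trace \<rho> = 1" "mat_adjoint \<rho> = \<rho>"
  using assms by (auto simp: density_mat_def psd_mat_def)

lemma density_mat_qform_nonneg: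
  "density_mat d \<rho> \<Longrightarrow> v \<in> carrier_vec d \<Longrightarrow> 0 \<le> qform \<rho> v"
  using psd_mat_iff_qform by (auto simp: density_mat_def)

lemma density_mat_sum_qform:
  "density_mat d \<rho> \<Longrightarrow> unitary_mat d V \<Longrightarrow> (\<Sum>i<d. qform \<rho> (col V i)) = 1"
  using qform_trace[of \<rho> d V] by (simp add: density_mat_def)

text \<open>The constant is kept abstract so that finite and infinite max-relative entropy share one
  argument. The hypothesis \<open>le\<close> bounds the quotient of \<open>sqrt p\<close> by
  \<open>sqrt p + sqrt q\<close> for each outcome.\<close>

lemma fidelity_lower_bound:
  assumes "density_mat d \<rho>" "density_mat d \<sigma>" "0 \<le> c"
    and le: "\<And>v. v \<in> carrier_vec d \<Longrightarrow> sqrt (qform \<rho> v) \<le> c * (sqrt (qform \<rho> v) + sqrt (qform \<sigma> v))"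
  shows "1 - 1 / 2 * c * trace_norm (\<rho> - \<sigma>) \<le> fidelity \<rho> \<sigma>"
proof -
  note r = density_matD[OF assms(1)] and s = density_matD[OF assms(2)]
  obtain V where V: "unitary_mat d V"
    and F: "fidelity \<rho> \<sigma> = (\<Sum>i<d. sqrt (qform \<rho> (col V i) * qform \<sigma> (col V i)))"
    using fuchs_caves_measurement[OF r(1) s(1) r(2) s(2)] .
  let ?p = "\<lambda>i. qform \<rho> (col V i)" and ?q = "\<lambda>i. qform \<sigma> (col V i)"
  \<comment> \<open>The right side is \<open>c\<close> times the positive part of the difference,
    written without a maximum: the linear terms cancel in the sum, since both distributions have
    total mass one.\<close>
  have "?p i - sqrt (?p i * ?q i) \<le> c / 2 * (\<bar>?p i - ?q i\<bar> + (?p i - ?q i))" if "i < d" for i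
  proof -
    have v: "col V i \<in> carrier_vec d" using V that by (rule unitary_col_carrier)
    define a b where "a = sqrt (?p i)" and "b = sqrt (?q i)"
    have ab: "0 \<le> a" "0 \<le> b" "a \<le> c * (a + b)" and p: "?p i = a\<^sup>2" and q: "?q i = b\<^sup>2"
      using density_mat_qform_nonneg[OF assms(1) v] density_mat_qform_nonneg[OF assms(2) v] le[OF v]
      by (auto simp: a_def b_def)
    have sqrt: "sqrt (?p i * ?q i) = a * b"
      using ab unfolding p q by (simp add: real_sqrt_mult)
    show ?thesis
    proof (cases "b \<le> a")
      case True
      \<comment> \<open>Here \<open>a * (a - b)\<close> is compared with
        \<open>c * (a + b) * (a - b)\<close>, the difference of squares.\<close>
      then have "b\<^sup>2 \<le> a\<^sup>2" using ab by (intro power_mono)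
      moreover have "a * (a - b) \<le> c * (a + b) * (a - b)"
        using ab True by (intro mult_right_mono) auto
      ultimately show ?thesis
        unfolding sqrt unfolding p q by (simp add: power2_eq_square algebra_simps)
    next
      case False
      \<comment> \<open>Now the positive part is zero and the left side is at most zero.\<close>
      then have "a * a \<le> a * b" "a\<^sup>2 \<le> b\<^sup>2"
        using ab by (auto intro: mult_left_mono power_mono)
      then show ?thesis
        unfolding sqrt unfolding p q by (simp add: power2_eq_square)
    qed
  qed
  then have "(\<Sum>i<d. ?p i - sqrt (?p i * ?q i)) \<le> (\<Sum>i<d. c / 2 * (\<bar>?p i - ?q i\<bar> + (?p i - ?q i)))"
    by (intro sum_mono) auto
  also have "\<dots> = c / 2 * ((\<Sum>i<d. \<bar>?p i - ?q i\<bar>) + ((\<Sum>i<d. ?p i) - (\<Sum>i<d. ?q i)))"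
    by (simp only: sum_distrib_left[symmetric] sum.distrib sum_subtractf)
  finally have "1 - fidelity \<rho> \<sigma> \<le> c / 2 * (\<Sum>i<d. \<bar>?p i - ?q i\<bar>)"
    using density_mat_sum_qform[OF assms(1) V] density_mat_sum_qform[OF assms(2) V]
    by (simp add: F sum_subtractf)
  also have "(\<Sum>i<d. \<bar>?p i - ?q i\<bar>) = (\<Sum>i<d. \<bar>qform (\<rho> - \<sigma>) (col V i)\<bar>)"
    using r(1) s(1) unitary_col_carrier[OF V] by (intro sum.cong) (auto simp: qform_minus[of _ d])
  also have "\<dots> \<le> trace_norm (\<rho> - \<sigma>)"
    using r s V by (intro sum_abs_qform_le_trace_norm) (auto simp: mat_adjoint_minus[of _ d d])
  finally show ?thesis
    using assms(3) by (simp add: mult_left_mono)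
qed

section \<open>Max-relative entropy and the final estimate\<close>

lemma loewner_le_iff_qform:
  assumes "density_mat d \<rho>" "density_mat d \<sigma>"
  shows "loewner_le \<rho> (complex_of_real c \<cdot>\<^sub>m \<sigma>) \<longleftrightarrow>
    (\<forall>v \<in> carrier_vec d. qform \<rho> v \<le> c * qform \<sigma> v)"
proof -
  note r = density_matD[OF assms(1)] and s = density_matD[OF assms(2)]
  have "mat_adjoint (complex_of_real c \<cdot>\<^sub>m \<sigma>) = complex_of_real c \<cdot>\<^sub>m mat_adjoint \<sigma>"
    by (rule eq_matI) auto
  then have "mat_adjoint (complex_of_real c \<cdot>\<^sub>m \<sigma> - \<rho>) = complex_of_real c \<cdot>\<^sub>m \<sigma> - \<rho>"
    using r s by (simp add: mat_adjoint_minus[of _ d d])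
  moreover have "complex_of_real c \<cdot>\<^sub>m \<sigma> - \<rho> \<in> carrier_mat d d"
    using r(1) s(1) by auto
  ultimately show ?thesis
    using r(1) s(1) by (simp add: loewner_le_def psd_mat_iff_qform[of _ d] qform_minus[of _ d]
        qform_smult[of _ d])
qed

text \<open>The point is that the least admissible exponent exists: \<open>S\<close> is nonempty,
  bounded below and contains its infimum.\<close>

lemma qform_le_exp_max_rel_entropy:
  assumes "density_mat d \<rho>" "density_mat d \<sigma>" "max_rel_entropy \<rho> \<sigma> \<noteq> \<infinity>" "v \<in> carrier_vec d"
  shows "qform \<rho> v \<le> exp (real_of_ereal (max_rel_entropy \<rho> \<sigma>)) * qform \<sigma> v"
proof -
  define S where "S = {\<gamma>::real. loewner_le \<rho> (complex_of_real (exp \<gamma>) \<cdot>\<^sub>m \<sigma>)}"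
  have S_iff: "\<gamma> \<in> S \<longleftrightarrow> (\<forall>v \<in> carrier_vec d. qform \<rho> v \<le> exp \<gamma> * qform \<sigma> v)" for \<gamma>
    using loewner_le_iff_qform[OF assms(1,2)] by (simp add: S_def)
  have ne: "S \<noteq> {}"
    using assms(3) by (auto simp: max_rel_entropy_def S_def split: if_splits)
  have "0 \<le> \<gamma>" if "\<gamma> \<in> S" for \<gamma>
  proof -
    \<comment> \<open>Summing over the standard basis takes traces, so the inequality becomes
      \<open>1 \<le> exp \<gamma>\<close>.\<close>
    have I: "unitary_mat d (1\<^sub>m d)" by (simp add: unitary_mat_def)
    have "(\<Sum>i<d. qform \<rho> (col (1\<^sub>m d) i)) \<le> (\<Sum>i<d. exp \<gamma> * qform \<sigma> (col (1\<^sub>m d) i))"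
      using that unitary_col_carrier[OF I] by (intro sum_mono) (simp add: S_iff)
    then show ?thesis
      using density_mat_sum_qform[OF assms(1) I] density_mat_sum_qform[OF assms(2) I]
      by (simp flip: sum_distrib_left)
  qed
  then have bdd: "bdd_below S" by (rule bdd_belowI)
  \<comment> \<open>If this failed at \<open>v\<close>, the ratio of the two forms would exceed
    \<open>exp (Inf S)\<close>, and some member of \<open>S\<close> would lie below its logarithm
    and violate the inequality at \<open>v\<close>. The denominator is positive because any member
    of \<open>S\<close> forces \<open>qform \<rho> v\<close> to vanish with
    \<open>qform \<sigma> v\<close>.\<close>
  have "qform \<rho> v \<le> exp (Inf S) * qform \<sigma> v" if v: "v \<in> carrier_vec d" for v
  proof (rule ccontr)
    assume less: "\<not> ?thesis"
    have p: "0 \<le> qform \<rho> v" and q: "0 \<le> qform \<sigma> v"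
      using assms(1,2) v by (auto intro: density_mat_qform_nonneg)
    obtain \<gamma> where "\<gamma> \<in> S" using ne by blast
    then have "qform \<rho> v \<le> exp \<gamma> * qform \<sigma> v" using v by (simp add: S_iff)
    then have q0: "0 < qform \<sigma> v"
      using less q by (cases "qform \<sigma> v = 0") auto
    then have "exp (Inf S) < qform \<rho> v / qform \<sigma> v"
      using less by (simp add: field_simps)
    then have "Inf S < ln (qform \<rho> v / qform \<sigma> v)"
      by (metis exp_gt_zero exp_less_cancel_iff exp_ln less_trans)
    then obtain \<gamma> where g: "\<gamma> \<in> S" "\<gamma> < ln (qform \<rho> v / qform \<sigma> v)"
      using cInf_lessD[OF ne] by blast
    have "0 < qform \<rho> v / qform \<sigma> v"
      using \<open>exp (Inf S) < _\<close> by (meson exp_gt_zero less_trans)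
    then have "exp \<gamma> < qform \<rho> v / qform \<sigma> v"
      using g(2) by (metis exp_less_cancel_iff exp_ln)
    then show False
      using g(1) v q0 by (auto simp: S_iff field_simps)
  qed
  then have Inf: "Inf S \<in> S" by (simp add: S_iff)
  have "(LEAST \<gamma>::real. \<gamma> \<in> S) = Inf S"
    using Inf bdd by (intro Least_equality) (auto intro: cInf_lower)
  then have "real_of_ereal (max_rel_entropy \<rho> \<sigma>) = Inf S"
    using Inf assms(3) by (auto simp: max_rel_entropy_def S_def split: if_splits)
  then show ?thesis using Inf assms(4) by (simp add: S_iff)
qed

theorem theorem2p1:
  fixes d :: nat and \<rho> \<sigma> :: "complex mat"
  assumes "density_mat d \<rho>" and "density_mat d \<sigma>"
  shows "fidelity \<rho> \<sigma> \<ge>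
    1 - 1 / 2 *
      (if max_rel_entropy \<rho> \<sigma> = \<infinity> then 1
       else exp (1 / 2 * real_of_ereal (max_rel_entropy \<rho> \<sigma>)) /
            (1 + exp (1 / 2 * real_of_ereal (max_rel_entropy \<rho> \<sigma>)))) *
      trace_norm (\<rho> - \<sigma>)"
proof (cases "max_rel_entropy \<rho> \<sigma> = \<infinity>")
  case True
  \<comment> \<open>With \<open>c = 1\<close> the required bound is just nonnegativity of
    \<open>sqrt (qform \<sigma> v)\<close>.\<close>
  have "1 - 1 / 2 * 1 * trace_norm (\<rho> - \<sigma>) \<le> fidelity \<rho> \<sigma>"
    using assms by (intro fidelity_lower_bound[of d]) (auto intro: density_mat_qform_nonneg)
  then show ?thesis using True by simp
next
  case False
  define \<gamma> where "\<gamma> = real_of_ereal (max_rel_entropy \<rho> \<sigma>)"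
  define l where "l = exp (1 / 2 * \<gamma>)"
  have l: "0 < l" "exp \<gamma> = l\<^sup>2"
    by (auto simp: l_def power2_eq_square simp flip: exp_add)
  have "1 - 1 / 2 * (l / (1 + l)) * trace_norm (\<rho> - \<sigma>) \<le> fidelity \<rho> \<sigma>"
    using assms
  proof (rule fidelity_lower_bound)
    fix v :: "complex vec" assume v: "v \<in> carrier_vec d"
    have "sqrt (qform \<rho> v) \<le> sqrt (l\<^sup>2 * qform \<sigma> v)"
      using qform_le_exp_max_rel_entropy[OF assms False v] l by (simp add: \<gamma>_def)
    also have "\<dots> = l * sqrt (qform \<sigma> v)"
      using l by (simp add: real_sqrt_mult)
    \<comment> \<open>From \<open>a \<le> l * b\<close>, adding \<open>l * a\<close> to both sides
      and dividing by \<open>1 + l\<close> gives the bound.\<close>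
    finally show "sqrt (qform \<rho> v) \<le> l / (1 + l) * (sqrt (qform \<rho> v) + sqrt (qform \<sigma> v))"
      using l by (simp add: field_simps)
  qed (use l in simp)
  then show ?thesis using False by (simp add: l_def \<gamma>_def)
qed

end
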